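(* Let $\mathbf{x}^{*}$ be an optimal solution of the convexified optimal energy flow problem, let $g_l^{*}$ ($l\in\mathcal{L}_g$) be the gas flows through the passive pipelines in $\mathbf{x}^{*}$ and $\boldsymbol{\pi}^{*}$ the vector of squared pressures in $\mathbf{x}^{*}$. Assume that the recovery problem associated with $(g_l^{*})_l$ is feasible and its (optimal) objective value is equal to zero, and let $\boldsymbol{\pi}^{**}$ be the $\boldsymbol\pi$-component of a feasible solution of the recovery problem with objective value zero. Let $\mathbf{x}_{opt}$ be obtained from $\mathbf{x}^{*}$ by replacing $\boldsymbol{\pi}^{*}$ by $\boldsymbol{\pi}^{**}$. Then $\mathbf{x}_{opt}$ is an optimal solution of the original optimal energy flow problem.
   Context: **Setting.** An integrated electricity-gas system is divided into $N\ge 2$ blocks: power blocks $r=1,\dots,N-1$ and one gas block. All sets are finite. Capital-letter quantities, $\mathrm{x}_l$, $\alpha_c$, $\chi_g$, $\mathrm{W}_l>0$ and all cost coefficients are given real constants. **Power block $r$.** Sets: coal-fired generators $\mathcal{G}_p^r$, gas-fired generators $\mathcal{G}_g^r$, lines $\mathcal{L}_p^r$, actual power nodes $\mathcal{N}_p^r$, virtual power nodes $\mathcal{N}_v^r$ (each is a replica of an actual node of another power block), loads $\mathcal{D}_p^r$. Variables: coal-fired outputs $p_g$, gas-fired outputs $g_g$, phase angles $\theta_i$ (of actual and virtual nodes), line flows $p_l$. Constraints: - (P1) $\mathrm{P}_g^{\min}\le p_g\le \mathrm{P}_g^{\max}$ for $g\in\mathcal{G}_p^r$; $\mathrm{G}_g^{\min}\le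 g_g\le \mathrm{G}_g^{\max}$ for $g\in\mathcal{G}_g^r$; $\theta_i^{\min}\le\theta_i\le\theta_i^{\max}$ for $i\in\mathcal{N}_p^r$; $-\mathrm{P}_l\le p_l\le \mathrm{P}_l$ for $l\in\mathcal{L}_p^r$. - (P2) $\mathrm{x}_l p_l=\theta_{i(l)}-\theta_{j(l)}$ for $l\in\mathcal{L}_p^r$, where $i(l),j(l)$ are the end nodes of $l$ in block $r$ (one of them may be virtual). - (P3) at each actual node $i\in\mathcal{N}_p^r$: (sum of $p_g$ of coal-fired generators at $i$) + (sum of $g_g$ of gas-fired generators at $i$) + (sum of $p_l$ over lines into $i$) − (sum of $p_l$ over lines out of $i$) = (sum of loads $\mathrm{P}_d$ at $i$). **Gas block.** Sets: gas wells $\mathcal{W}$, gas nodes $\mathcal{N}_g$, passive pipelines $\mathcal{L}_g$, compressors (active pipelines) $\mathcal{C}_g$, loads $\mathcal{D}_g$, virtual gas-fired generators $\mathcal{G}_v$ (each a replica of an actual gas-fired generator in a power block). Each passive pipeline $l$ joins nodes $i(l)$ and $j(l)$ (reference direction $i(l)\to j(l)$); each compressor $c$ has inflow node $i(c)$ and outflow node $j(c)$. Variables: well outputs $g_w$, passive pipeline flows $g_l$, compressor flows $g_c$, squared node pressures $\pi_i$, virtual generator outputs $g_{g'}$. Constraints: - (G1) $\mathrm{G}_w^{\min}\le g_w\le \mathrm{G}_w^{\max}$ for $w\in\mathcal{W}$; $0\le g_c\le \mathrm{G}_c$ for $c\in\mathcal{C}_g$. - (G2) $\mathrm{G}_i^{\min}\le\pi_i\le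 \mathrm{G}_i^{\max}$ for $i\in\mathcal{N}_g$. - (G3) (Weymouth equation) $g_l^2\,\mathrm{sgn}(g_l)=\mathrm{W}_l(\pi_{i(l)}-\pi_{j(l)})$ for $l\in\mathcal{L}_g$, where $\mathrm{sgn}(t)=1$ if $t\ge0$ and $-1$ if $t<0$. (If the flow direction of $l$ is fixed, it is additionally required that $\pi_{i(l)}\ge\pi_{j(l)}$.) - (G4) $\pi_{j(c)}\le\alpha_c\pi_{i(c)}$ for $c\in\mathcal{C}_g$. - (G5) at each $i\in\mathcal{N}_g$: (sum of $g_w$ of wells at $i$) + (sum of passive pipeline flows into $i$) − (sum of passive pipeline flows out of $i$) + (sum of compressor flows into $i$) − (sum of compressor flows out of $i$) = (sum of loads $\mathrm{G}_d$ at $i$) + (sum of $\chi_g\, g_{g'}$ over virtual gas-fired generators at $i$). **Coupling constraints.** $\theta_i=\theta_{i'}$ for every virtual power node $i'$ and the actual node $i$ it replicates; $g_g=g_{g'}$ for every virtual gas-fired generator $g'$ and the actual gas-fired generator $g$ it replicates. **Original problem.** Minimize $\sum_{r=1}^{N-1}\sum_{g\in\mathcal{G}_p^r}\mathrm{C}_p(p_g)+\sum_{w\in\mathcal{W}}\mathrm{C}_w g_w$, where $\mathrm{C}_p(p)=\mathrm{c}_1p^2+\mathrm{c}_2p+\mathrm{c}_3$ with $\mathrm{c}_1>0$ (coefficients may depend on the generator), subject to (P1)–(P3) for all $r$, (G1)–(G5), and the coupling constraints. It is assumed feasible. **Convexified problem.** The same problem with (G3) replaced, for each $l\in\mathcal{L}_g$,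 by its extended convex hull (ECH). Let $\mathcal{Y}_l$ be the set of pairs $(\pi_{i(l)}-\pi_{j(l)},g_l)$ satisfying (G3) with $\pi_{i(l)},\pi_{j(l)}$ within the limits (G2). The ECH is a convex set containing the convex hull of $\mathcal{Y}_l$. It has one of two forms: - form A (general case): $\mathrm{G}_l^{\min}\le g_l\le \mathrm{G}_l^{\max}$, $\ \mathrm{a}_l^{\mathrm L}(\pi_{i(l)}-\pi_{j(l)})+\mathrm{b}_l^{\mathrm L}\le g_l\le \mathrm{a}_l^{\mathrm U}(\pi_{i(l)}-\pi_{j(l)})+\mathrm{b}_l^{\mathrm U}$, with constants such that the region contains $\mathcal{Y}_l$; - form B (when $\mathrm{G}_{i(l)}^{\min}\ge \mathrm{G}_{j(l)}^{\max}$, or the flow direction of $l$ is fixed): $\mathrm{a}_l^{\mathrm U}(\pi_{i(l)}-\pi_{j(l)})+\mathrm{b}_l^{\mathrm U}\le g_l$ and $g_l^2\le \mathrm{W}_l(\pi_{i(l)}-\pi_{j(l)})$, where the linear inequality is given by the chord joining the end points of the curve $\mathcal{Y}_l$, so that the ECH equals the convex hull of $\mathcal{Y}_l$. **Recovery problem associated with $(g_l^* )_{l\in\mathcal{L}_g}$.** In the variables $\boldsymbol\pi=(\pi_i)$, $\boldsymbol\delta^+=(\delta_i^+)$, $\boldsymbol\delta^-=(\delta_i^-)$, $i\in\mathcal{N}_g$: $$\min\ \sum_{i}\delta_i^+ +\sum_i\delta_i^-$$ subject to $(g_l^* )^2\,\mathrm{sgn}(g_l^* )=\mathrm{W}_l(\pi_{i(l)}-\pi_{j(l)})$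 for $l\in\mathcal{L}_g$; $(1-\delta_i^-)\mathrm{G}_i^{\min}\le\pi_i\le(1+\delta_i^+)\mathrm{G}_i^{\max}$ for $i\in\mathcal{N}_g$; $\pi_{j(c)}\le\alpha_c\pi_{i(c)}$ for $c\in\mathcal{C}_g$; $\delta_i^+,\delta_i^-\ge0$ for $i\in\mathcal{N}_g$. *)

theory Defs
  imports Complex_Main
begin

text \<open>
  Index sets are sets over type variables: \<open>'u\<close> generating units, \<open>'n\<close> power nodes,
  \<open>'l\<close> power lines, \<open>'d\<close> loads, \<open>'w\<close> gas wells, \<open>'m\<close> gas nodes, \<open>'e\<close> passive pipelines,
  \<open>'c\<close> compressors, \<open>'v\<close> virtual gas-fired generators.
  Quantities of a power block are always addressed by a pair of block number and label, so labels
  of different blocks need not be disjoint.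
\<close>

record ('u, 'n, 'l, 'd) power_block =
  coal_gens :: "'u set"
  gas_gens :: "'u set"
  lines :: "'l set"
  actual_nodes :: "'n set"
  virtual_nodes :: "'n set"
  power_loads :: "'d set"
  gen_node :: "'u \<Rightarrow> 'n"
  line_from :: "'l \<Rightarrow> 'n"
  line_to :: "'l \<Rightarrow> 'n"
  power_load_node :: "'d \<Rightarrow> 'n"
  node_replicated :: "'n \<Rightarrow> nat \<times> 'n"  \<comment> \<open>block and label of the actual node\<close>
  P_gen_min :: "'u \<Rightarrow> real"
  P_gen_max :: "'u \<Rightarrow> real"
  G_gen_min :: "'u \<Rightarrow> real"
  G_gen_max :: "'u \<Rightarrow> real"
  theta_min :: "'n \<Rightarrow> real"
  theta_max :: "'n \<Rightarrow> real"
  P_line :: "'l \<Rightarrow> real"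
  x_line :: "'l \<Rightarrow> real"
  P_load :: "'d \<Rightarrow> real"
  c1 :: "'u \<Rightarrow> real"
  c2 :: "'u \<Rightarrow> real"
  c3 :: "'u \<Rightarrow> real"
  chi :: "'u \<Rightarrow> real"

record ('u, 'd, 'w, 'm, 'e, 'c, 'v) gas_block =
  wells :: "'w set"
  gas_nodes :: "'m set"
  pipes :: "'e set"
  fixed_pipes :: "'e set"  \<comment> \<open>passive pipelines with fixed flow direction\<close>
  compressors :: "'c set"
  gas_loads :: "'d set"
  virtual_gens :: "'v set"
  well_node :: "'w \<Rightarrow> 'm"
  pipe_from :: "'e \<Rightarrow> 'm"
  pipe_to :: "'e \<Rightarrow> 'm"
  comp_from :: "'c \<Rightarrow> 'm"
  comp_to :: "'c \<Rightarrow> 'm"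
  gas_load_node :: "'d \<Rightarrow> 'm"
  virtual_gen_node :: "'v \<Rightarrow> 'm"
  gen_replicated :: "'v \<Rightarrow> nat \<times> 'u"  \<comment> \<open>block and label of the actual generator\<close>
  G_well_min :: "'w \<Rightarrow> real"
  G_well_max :: "'w \<Rightarrow> real"
  G_comp :: "'c \<Rightarrow> real"
  G_node_min :: "'m \<Rightarrow> real"
  G_node_max :: "'m \<Rightarrow> real"
  W_pipe :: "'e \<Rightarrow> real"
  alpha :: "'c \<Rightarrow> real"
  G_load :: "'d \<Rightarrow> real"
  C_well :: "'w \<Rightarrow> real"

record ('u, 'n, 'l, 'd, 'w, 'm, 'e, 'c, 'v) energy_system =
  num_blocks :: nat
  power :: "nat \<Rightarrow> ('u, 'n, 'l, 'd) power_block"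
  gas :: "('u, 'd, 'w, 'm, 'e, 'c, 'v) gas_block"

text \<open>The decision variables; values outside the index sets of a system are irrelevant.\<close>

record ('u, 'n, 'l, 'w, 'm, 'e, 'c, 'v) flow =
  coal_out :: "nat \<Rightarrow> 'u \<Rightarrow> real"
  gas_out :: "nat \<Rightarrow> 'u \<Rightarrow> real"
  angle :: "nat \<Rightarrow> 'n \<Rightarrow> real"
  line_flow :: "nat \<Rightarrow> 'l \<Rightarrow> real"
  well_out :: "'w \<Rightarrow> real"
  pipe_flow :: "'e \<Rightarrow> real"
  comp_flow :: "'c \<Rightarrow> real"
  pressure :: "'m \<Rightarrow> real"  \<comment> \<open>squared pressures\<close>
  virtual_out :: "'v \<Rightarrow> real"

abbreviation power_indices ::
    "('u, 'n, 'l, 'd, 'w, 'm, 'e, 'c, 'v) energy_system \<Rightarrow> nat set" where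
  "power_indices S \<equiv> {1..num_blocks S - 1}"

definition wf_power_block ::
    "('u, 'n, 'l, 'd, 'w, 'm, 'e, 'c, 'v) energy_system \<Rightarrow> nat \<Rightarrow> bool" where
  "wf_power_block S r \<longleftrightarrow> (let B = power S r in
     finite (coal_gens B) \<and> finite (gas_gens B) \<and> finite (lines B) \<and>
     finite (actual_nodes B) \<and> finite (virtual_nodes B) \<and> finite (power_loads B) \<and>
     actual_nodes B \<inter> virtual_nodes B = {} \<and>
     (\<forall>g\<in>coal_gens B \<union> gas_gens B. gen_node B g \<in> actual_nodes B) \<and>
     (\<forall>d\<in>power_loads B. power_load_node B d \<in> actual_nodes B) \<and>
     (\<forall>l\<in>lines B.
        line_from B l \<in> actual_nodes B \<union> virtual_nodes B \<and>
        line_to B l \<in> actual_nodes B \<union> virtual_nodes B \<and>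
        (line_from B l \<in> actual_nodes B \<or> line_to B l \<in> actual_nodes B)) \<and>
     (\<forall>i'\<in>virtual_nodes B. case node_replicated B i' of (s, i) \<Rightarrow>
        s \<in> power_indices S \<and> s \<noteq> r \<and> i \<in> actual_nodes (power S s)) \<and>
     (\<forall>g\<in>coal_gens B. c1 B g > 0))"

definition wf_gas_block ::
    "('u, 'n, 'l, 'd, 'w, 'm, 'e, 'c, 'v) energy_system \<Rightarrow> bool" where
  "wf_gas_block S \<longleftrightarrow> (let B = gas S in
     finite (wells B) \<and> finite (gas_nodes B) \<and> finite (pipes B) \<and>
     finite (compressors B) \<and> finite (gas_loads B) \<and> finite (virtual_gens B) \<and>
     fixed_pipes B \<subseteq> pipes B \<and>
     (\<forall>w\<in>wells B. well_node B w \<in> gas_nodes B) \<and>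
     (\<forall>l\<in>pipes B. pipe_from B l \<in> gas_nodes B \<and> pipe_to B l \<in> gas_nodes B) \<and>
     (\<forall>c\<in>compressors B. comp_from B c \<in> gas_nodes B \<and> comp_to B c \<in> gas_nodes B) \<and>
     (\<forall>d\<in>gas_loads B. gas_load_node B d \<in> gas_nodes B) \<and>
     (\<forall>v\<in>virtual_gens B. virtual_gen_node B v \<in> gas_nodes B \<and>
        (case gen_replicated B v of (r, g) \<Rightarrow>
           r \<in> power_indices S \<and> g \<in> gas_gens (power S r))) \<and>
     (\<forall>l\<in>pipes B. W_pipe B l > 0))"

definition wf_system ::
    "('u, 'n, 'l, 'd, 'w, 'm, 'e, 'c, 'v) energy_system \<Rightarrow> bool" where
  "wf_system S \<longleftrightarrow> num_blocks S \<ge> 2 \<and> (\<forall>r\<in>power_indices S. wf_power_block S r) \<and> wf_gas_block S"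

text \<open>\<open>p\<close>, \<open>g\<close>, \<open>\<theta>\<close>, \<open>f\<close> are coal-fired outputs, gas-fired outputs, phase angles and line flows.\<close>

definition power_constraints ::
    "('u, 'n, 'l, 'd) power_block \<Rightarrow> ('u \<Rightarrow> real) \<Rightarrow> ('u \<Rightarrow> real) \<Rightarrow>
     ('n \<Rightarrow> real) \<Rightarrow> ('l \<Rightarrow> real) \<Rightarrow> bool" where
  "power_constraints B p g \<theta> f \<longleftrightarrow>
     (\<forall>u\<in>coal_gens B. P_gen_min B u \<le> p u \<and> p u \<le> P_gen_max B u) \<and>
     (\<forall>u\<in>gas_gens B. G_gen_min B u \<le> g u \<and> g u \<le> G_gen_max B u) \<and>
     (\<forall>i\<in>actual_nodes B. theta_min B i \<le> \<theta> i \<and> \<theta> i \<le> theta_max B i) \<and>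
     (\<forall>l\<in>lines B. - P_line B l \<le> f l \<and> f l \<le> P_line B l) \<and>
     (\<forall>l\<in>lines B. x_line B l * f l = \<theta> (line_from B l) - \<theta> (line_to B l)) \<and>
     (\<forall>i\<in>actual_nodes B.
        (\<Sum>u | u \<in> coal_gens B \<and> gen_node B u = i. p u)
        + (\<Sum>u | u \<in> gas_gens B \<and> gen_node B u = i. g u)
        + (\<Sum>l | l \<in> lines B \<and> line_to B l = i. f l)
        - (\<Sum>l | l \<in> lines B \<and> line_from B l = i. f l)
        = (\<Sum>d | d \<in> power_loads B \<and> power_load_node B d = i. P_load B d))"

definition pressure_limits ::
    "('u, 'd, 'w, 'm, 'e, 'c, 'v) gas_block \<Rightarrow> ('m \<Rightarrow> real) \<Rightarrow> 'm \<Rightarrow> bool" where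
  "pressure_limits B \<pi> i \<longleftrightarrow> G_node_min B i \<le> \<pi> i \<and> \<pi> i \<le> G_node_max B i"

text \<open>Unlike the library's \<^const>\<open>sgn\<close>, this takes the value 1 at 0.\<close>

definition sgn1 :: "real \<Rightarrow> real" where
  "sgn1 t = (if t \<ge> 0 then 1 else - 1)"

definition weymouth ::
    "('u, 'd, 'w, 'm, 'e, 'c, 'v) gas_block \<Rightarrow> 'e \<Rightarrow> ('m \<Rightarrow> real) \<Rightarrow> real \<Rightarrow> bool" where
  "weymouth B l \<pi> f \<longleftrightarrow> f\<^sup>2 * sgn1 f = W_pipe B l * (\<pi> (pipe_from B l) - \<pi> (pipe_to B l))"

definition weymouth_constraint ::
    "('u, 'd, 'w, 'm, 'e, 'c, 'v) gas_block \<Rightarrow> 'e \<Rightarrow> ('m \<Rightarrow> real) \<Rightarrow> real \<Rightarrow> bool" where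
  "weymouth_constraint B l \<pi> f \<longleftrightarrow> weymouth B l \<pi> f \<and>
     (l \<in> fixed_pipes B \<longrightarrow> \<pi> (pipe_from B l) \<ge> \<pi> (pipe_to B l))"

definition compressor_constraints ::
    "('u, 'd, 'w, 'm, 'e, 'c, 'v) gas_block \<Rightarrow> ('m \<Rightarrow> real) \<Rightarrow> bool" where
  "compressor_constraints B \<pi> \<longleftrightarrow>
     (\<forall>c\<in>compressors B. \<pi> (comp_to B c) \<le> alpha B c * \<pi> (comp_from B c))"

definition gas_balance ::
    "('u, 'n, 'l, 'd, 'w, 'm, 'e, 'c, 'v) energy_system \<Rightarrow>
     ('u, 'n, 'l, 'w, 'm, 'e, 'c, 'v) flow \<Rightarrow> 'm \<Rightarrow> bool" where
  "gas_balance S x i \<longleftrightarrow> (let B = gas S in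
     (\<Sum>w | w \<in> wells B \<and> well_node B w = i. well_out x w)
     + (\<Sum>l | l \<in> pipes B \<and> pipe_to B l = i. pipe_flow x l)
     - (\<Sum>l | l \<in> pipes B \<and> pipe_from B l = i. pipe_flow x l)
     + (\<Sum>c | c \<in> compressors B \<and> comp_to B c = i. comp_flow x c)
     - (\<Sum>c | c \<in> compressors B \<and> comp_from B c = i. comp_flow x c)
     = (\<Sum>d | d \<in> gas_loads B \<and> gas_load_node B d = i. G_load B d)
       + (\<Sum>v | v \<in> virtual_gens B \<and> virtual_gen_node B v = i.
            (case gen_replicated B v of (r, g) \<Rightarrow> chi (power S r) g) * virtual_out x v))"

text \<open>All gas constraints except the Weymouth equations.\<close>

definition gas_constraints ::
    "('u, 'n, 'l, 'd, 'w, 'm, 'e, 'c, 'v) energy_system \<Rightarrow>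
     ('u, 'n, 'l, 'w, 'm, 'e, 'c, 'v) flow \<Rightarrow> bool" where
  "gas_constraints S x \<longleftrightarrow> (let B = gas S in
     (\<forall>w\<in>wells B. G_well_min B w \<le> well_out x w \<and> well_out x w \<le> G_well_max B w) \<and>
     (\<forall>c\<in>compressors B. 0 \<le> comp_flow x c \<and> comp_flow x c \<le> G_comp B c) \<and>
     (\<forall>i\<in>gas_nodes B. pressure_limits B (pressure x) i) \<and>
     compressor_constraints B (pressure x) \<and>
     (\<forall>i\<in>gas_nodes B. gas_balance S x i))"

definition coupling_constraints ::
    "('u, 'n, 'l, 'd, 'w, 'm, 'e, 'c, 'v) energy_system \<Rightarrow>
     ('u, 'n, 'l, 'w, 'm, 'e, 'c, 'v) flow \<Rightarrow> bool" where
  "coupling_constraints S x \<longleftrightarrow>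
     (\<forall>r\<in>power_indices S. \<forall>i'\<in>virtual_nodes (power S r).
        case node_replicated (power S r) i' of (s, i) \<Rightarrow> angle x s i = angle x r i') \<and>
     (\<forall>v\<in>virtual_gens (gas S).
        case gen_replicated (gas S) v of (r, g) \<Rightarrow> gas_out x r g = virtual_out x v)"

definition common_constraints ::
    "('u, 'n, 'l, 'd, 'w, 'm, 'e, 'c, 'v) energy_system \<Rightarrow>
     ('u, 'n, 'l, 'w, 'm, 'e, 'c, 'v) flow \<Rightarrow> bool" where
  "common_constraints S x \<longleftrightarrow>
     (\<forall>r\<in>power_indices S.
        power_constraints (power S r) (coal_out x r) (gas_out x r) (angle x r) (line_flow x r)) \<and>
     gas_constraints S x \<and> coupling_constraints S x"

definition total_cost ::
    "('u, 'n, 'l, 'd, 'w, 'm, 'e, 'c, 'v) energy_system \<Rightarrow>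
     ('u, 'n, 'l, 'w, 'm, 'e, 'c, 'v) flow \<Rightarrow> real" where
  "total_cost S x =
     (\<Sum>r\<in>power_indices S. \<Sum>u\<in>coal_gens (power S r).
        c1 (power S r) u * (coal_out x r u)\<^sup>2 + c2 (power S r) u * coal_out x r u + c3 (power S r) u)
     + (\<Sum>w\<in>wells (gas S). C_well (gas S) w * well_out x w)"

definition original_feasible ::
    "('u, 'n, 'l, 'd, 'w, 'm, 'e, 'c, 'v) energy_system \<Rightarrow>
     ('u, 'n, 'l, 'w, 'm, 'e, 'c, 'v) flow \<Rightarrow> bool" where
  "original_feasible S x \<longleftrightarrow> common_constraints S x \<and>
     (\<forall>l\<in>pipes (gas S). weymouth_constraint (gas S) l (pressure x) (pipe_flow x l))"

definition weymouth_curve ::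
    "('u, 'd, 'w, 'm, 'e, 'c, 'v) gas_block \<Rightarrow> 'e \<Rightarrow> (real \<times> real) set" where
  "weymouth_curve B l =
     {(\<pi> (pipe_from B l) - \<pi> (pipe_to B l), f) | \<pi> f.
        weymouth_constraint B l \<pi> f \<and>
        pressure_limits B \<pi> (pipe_from B l) \<and> pressure_limits B \<pi> (pipe_to B l)}"

text \<open>
  The data of an extended convex hull (ECH): in the general form flow limits, then slope and
  intercept of the lower and of the upper line; in the chord form slope and intercept of the chord.
\<close>

datatype ech =
    General_Form (flow_min: real) (flow_max: real)
      (lower_slope: real) (lower_icpt: real) (upper_slope: real) (upper_icpt: real)
  | Chord_Form (chord_slope: real) (chord_icpt: real)

fun ech_region :: "real \<Rightarrow> ech \<Rightarrow> (real \<times> real) set" where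
  "ech_region W (General_Form gmin gmax aL bL aU bU) =
     {(d, f). gmin \<le> f \<and> f \<le> gmax \<and> aL * d + bL \<le> f \<and> f \<le> aU * d + bU}"
| "ech_region W (Chord_Form aU bU) = {(d, f). aU * d + bU \<le> f \<and> f\<^sup>2 \<le> W * d}"

text \<open>
  A Weymouth curve is the graph of a function over a closed interval of pressure differences; its
  end points \<open>u\<close>, \<open>v\<close> are the points over the two ends of that interval.
\<close>

definition chord_of_curve :: "(real \<times> real) set \<Rightarrow> real \<Rightarrow> real \<Rightarrow> bool" where
  "chord_of_curve Y a b \<longleftrightarrow>
     (\<exists>u\<in>Y. \<exists>v\<in>Y. (\<forall>y\<in>Y. fst u \<le> fst y \<and> fst y \<le> fst v) \<and>
        snd u = a * fst u + b \<and> snd v = a * fst v + b)"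

text \<open>
  Pipelines with fixed flow direction have the chord form: the general form would admit flows
  against the fixed direction.
\<close>

definition valid_ech ::
    "('u, 'd, 'w, 'm, 'e, 'c, 'v) gas_block \<Rightarrow> 'e \<Rightarrow> ech \<Rightarrow> bool" where
  "valid_ech B l E \<longleftrightarrow> (case E of
     General_Form _ _ _ _ _ _ \<Rightarrow>
       l \<notin> fixed_pipes B \<and> weymouth_curve B l \<subseteq> ech_region (W_pipe B l) E
   | Chord_Form aU bU \<Rightarrow>
       (G_node_min B (pipe_from B l) \<ge> G_node_max B (pipe_to B l) \<or> l \<in> fixed_pipes B) \<and>
       chord_of_curve (weymouth_curve B l) aU bU)"

definition convexified_feasible ::
    "('u, 'n, 'l, 'd, 'w, 'm, 'e, 'c, 'v) energy_system \<Rightarrow> ('e \<Rightarrow> ech) \<Rightarrow>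
     ('u, 'n, 'l, 'w, 'm, 'e, 'c, 'v) flow \<Rightarrow> bool" where
  "convexified_feasible S E x \<longleftrightarrow> common_constraints S x \<and>
     (\<forall>l\<in>pipes (gas S).
        (pressure x (pipe_from (gas S) l) - pressure x (pipe_to (gas S) l), pipe_flow x l)
          \<in> ech_region (W_pipe (gas S) l) (E l))"

text \<open>The recovery problem for pipeline flows \<open>f\<close>, in the variables \<open>(\<pi>, \<delta>\<^sup>+, \<delta>\<^sup>-)\<close>.\<close>

definition recovery_feasible ::
    "('u, 'd, 'w, 'm, 'e, 'c, 'v) gas_block \<Rightarrow> ('e \<Rightarrow> real) \<Rightarrow>
     (('m \<Rightarrow> real) \<times> ('m \<Rightarrow> real) \<times> ('m \<Rightarrow> real)) set" where
  "recovery_feasible B f = {(\<pi>, \<delta>p, \<delta>m).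
     (\<forall>l\<in>pipes B. weymouth B l \<pi> (f l)) \<and>
     (\<forall>i\<in>gas_nodes B.
        (1 - \<delta>m i) * G_node_min B i \<le> \<pi> i \<and> \<pi> i \<le> (1 + \<delta>p i) * G_node_max B i) \<and>
     compressor_constraints B \<pi> \<and>
     (\<forall>i\<in>gas_nodes B. 0 \<le> \<delta>p i \<and> 0 \<le> \<delta>m i)}"

definition recovery_objective ::
    "('u, 'd, 'w, 'm, 'e, 'c, 'v) gas_block \<Rightarrow>
     ('m \<Rightarrow> real) \<times> ('m \<Rightarrow> real) \<times> ('m \<Rightarrow> real) \<Rightarrow> real" where
  "recovery_objective B = (\<lambda>(\<pi>, \<delta>p, \<delta>m). (\<Sum>i\<in>gas_nodes B. \<delta>p i) + (\<Sum>i\<in>gas_nodes B. \<delta>m i))"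

end

theory Submission
  imports Defs
begin

text \<open>
  The convexified problem is a relaxation of the original one.  An ECH of the general form contains
  the Weymouth curve by definition.  Where the chord form is used, the pressure differences on the
  curve are nonnegative, so the curve is a piece of the graph of the concave function
  \<open>d \<mapsto> sqrt (W * d)\<close> and lies above its chord (lemma \<open>weymouth_in_ech\<close>).  Since the cost does
  not depend on the pressures, replacing them in an optimum of the relaxation keeps the cost, and
  the result is optimal for the original problem as soon as it is feasible there.

  A recovery solution with objective value zero has no slack, so its pressures satisfy the original
  pressure limits, the compressor constraints and the Weymouth equations for the given flows.  One
  requirement is not visible in the recovery problem: a pipeline with fixed direction needs a
  nonnegative pressure difference.  By the Weymouth equation this follows from a nonnegative flow,
  and the chord guarantees that: both of its end points lie on the curve, hence at nonnegative
  flows, and the old pressures satisfy the pressure limits, hence place the flow above a point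
  between them (lemma \<open>chord_form_fixed_flow_nonneg\<close>).
\<close>

lemma signed_square_nonneg_iff: "0 \<le> f\<^sup>2 * sgn1 f \<longleftrightarrow> 0 \<le> f"
proof (cases "0 \<le> f")
  case False
  then have "0 < f\<^sup>2" by simp
  with False show ?thesis by (simp add: sgn1_def)
qed (simp add: sgn1_def)

lemma weymouth_flow_nonneg_iff:
  assumes "weymouth B l \<pi> f" and "W_pipe B l > 0"
  shows "0 \<le> f \<longleftrightarrow> \<pi> (pipe_to B l) \<le> \<pi> (pipe_from B l)"
  using assms signed_square_nonneg_iff[of f]
  by (simp add: weymouth_def zero_le_mult_iff)

text \<open>
  Either reason for using the chord form leaves only the branch of the Weymouth curve where the flow
  follows the reference direction.
\<close>

lemma weymouth_curve_one_sided:
  assumes "(d, f) \<in> weymouth_curve B l" and W: "W_pipe B l > 0"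
    and one_sided: "G_node_min B (pipe_from B l) \<ge> G_node_max B (pipe_to B l) \<or> l \<in> fixed_pipes B"
  shows "0 \<le> f" and "f\<^sup>2 = W_pipe B l * d"
proof -
  obtain \<pi> where d: "d = \<pi> (pipe_from B l) - \<pi> (pipe_to B l)"
    and wc: "weymouth_constraint B l \<pi> f"
    and lim: "pressure_limits B \<pi> (pipe_from B l)" "pressure_limits B \<pi> (pipe_to B l)"
    using assms(1) by (auto simp: weymouth_curve_def)
  have wey: "weymouth B l \<pi> f"
    using wc by (simp add: weymouth_constraint_def)
  have "\<pi> (pipe_to B l) \<le> \<pi> (pipe_from B l)"
    using one_sided wc lim by (auto simp: weymouth_constraint_def pressure_limits_def)
  then show "0 \<le> f"
    using weymouth_flow_nonneg_iff[OF wey W] by simp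
  then show "f\<^sup>2 = W_pipe B l * d"
    using wey d by (simp add: weymouth_def sgn1_def)
qed

text \<open>
  Concavity of the square root, stated in the flow: over the flow the pressure difference is the
  parabola \<open>f\<^sup>2 / W\<close>, so \<open>a * d + b\<close> becomes a quadratic function of the flow that agrees with the
  identity at the two end points.  Subtracting these two equations gives \<open>(a / W) * (s + t) = 1\<close>
  unless \<open>s = t\<close>, so the quadratic is convex and stays below the identity between them.
\<close>

lemma parabola_below_chord:
  fixes q b s t f :: real
  assumes "0 \<le> s" and "s \<le> f" and "f \<le> t"
    and s: "q * s\<^sup>2 + b = s" and t: "q * t\<^sup>2 + b = t"
  shows "q * f\<^sup>2 + b \<le> f"
proof (cases "s = t")
  case True
  with assms show ?thesis by simp
next
  case False
  have "(t - s) * (q * (s + t)) = (t - s) * 1"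
    using s t by (simp add: algebra_simps power2_eq_square)
  then have slope: "q * (s + t) = 1"
    using False by (simp only: mult_cancel_left) simp
  moreover have "0 < s + t" using assms False by linarith
  ultimately have "0 < q"
    by (metis zero_less_mult_pos2 zero_less_one)
  then have "q * (s + f) \<le> 1"
    using slope assms by (metis add_left_mono less_imp_le mult_left_mono)
  then have "0 \<le> (f - s) * (1 - q * (s + f))"
    using assms by simp
  also have "\<dots> = f - (q * f\<^sup>2 + b)"
    using s by (simp add: algebra_simps power2_eq_square)
  finally show ?thesis by simp
qed

lemma chord_below_weymouth_curve:
  assumes y: "(d, f) \<in> weymouth_curve B l" and W: "W_pipe B l > 0"
    and one_sided: "G_node_min B (pipe_from B l) \<ge> G_node_max B (pipe_to B l) \<or> l \<in> fixed_pipes B"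
    and chord: "chord_of_curve (weymouth_curve B l) a b"
  shows "a * d + b \<le> f"
proof -
  let ?W = "W_pipe B l"
  obtain d1 f1 d2 f2 where
    ends: "(d1, f1) \<in> weymouth_curve B l" "(d2, f2) \<in> weymouth_curve B l"
    and between: "d1 \<le> d" "d \<le> d2"
    and line: "f1 = a * d1 + b" "f2 = a * d2 + b"
    using chord y unfolding chord_of_curve_def by fastforce
  note curve = weymouth_curve_one_sided[OF _ W one_sided]
  have "f1\<^sup>2 \<le> f\<^sup>2" "f\<^sup>2 \<le> f2\<^sup>2"
    using between W by (simp_all add: curve(2)[OF ends(1)] curve(2)[OF ends(2)] curve(2)[OF y])
  then have "f1 \<le> f" "f \<le> f2"
    using curve(1)[OF ends(2)] curve(1)[OF y] by (auto intro: power2_le_imp_le)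
  moreover have "a / ?W * f1\<^sup>2 + b = f1" "a / ?W * f2\<^sup>2 + b = f2"
    using W by (simp_all add: curve(2)[OF ends(1)] curve(2)[OF ends(2)] line[symmetric])
  ultimately have "a / ?W * f\<^sup>2 + b \<le> f"
    using parabola_below_chord curve(1)[OF ends(1)] by blast
  then show ?thesis
    using W by (simp add: curve(2)[OF y])
qed

lemma weymouth_in_ech:
  assumes y: "(d, f) \<in> weymouth_curve B l" and W: "W_pipe B l > 0" and E: "valid_ech B l E"
  shows "(d, f) \<in> ech_region (W_pipe B l) E"
proof (cases E)
  case General_Form
  then show ?thesis using E y by (auto simp: valid_ech_def)
next
  case (Chord_Form a b)
  then have one_sided:
      "G_node_min B (pipe_from B l) \<ge> G_node_max B (pipe_to B l) \<or> l \<in> fixed_pipes B"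
    and chord: "chord_of_curve (weymouth_curve B l) a b"
    using E by (auto simp: valid_ech_def)
  show ?thesis
    using Chord_Form chord_below_weymouth_curve[OF y W one_sided chord]
      weymouth_curve_one_sided(2)[OF y W one_sided] by simp
qed

lemma original_feasible_imp_convexified_feasible:
  assumes wf: "wf_system S" and E: "\<forall>l\<in>pipes (gas S). valid_ech (gas S) l (E l)"
    and x: "original_feasible S x"
  shows "convexified_feasible S E x"
  unfolding convexified_feasible_def
proof (intro conjI ballI)
  show "common_constraints S x" using x by (simp add: original_feasible_def)
next
  fix l assume l: "l \<in> pipes (gas S)"
  have nodes: "pipe_from (gas S) l \<in> gas_nodes (gas S)" "pipe_to (gas S) l \<in> gas_nodes (gas S)"
    and W: "W_pipe (gas S) l > 0"
    using wf l by (auto simp: wf_system_def wf_gas_block_def Let_def)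
  have "weymouth_constraint (gas S) l (pressure x) (pipe_flow x l)"
    "pressure_limits (gas S) (pressure x) (pipe_from (gas S) l)"
    "pressure_limits (gas S) (pressure x) (pipe_to (gas S) l)"
    using x l nodes
    by (auto simp: original_feasible_def common_constraints_def gas_constraints_def Let_def)
  then have "(pressure x (pipe_from (gas S) l) - pressure x (pipe_to (gas S) l), pipe_flow x l)
      \<in> weymouth_curve (gas S) l"
    by (auto simp: weymouth_curve_def)
  then show "(pressure x (pipe_from (gas S) l) - pressure x (pipe_to (gas S) l), pipe_flow x l)
      \<in> ech_region (W_pipe (gas S) l) (E l)"
    by (rule weymouth_in_ech) (use W E l in auto)
qed

text \<open>
  The chord does not fall below zero between its end points, and the pressure limits,
  with \<open>f\<^sup>2 \<le> W * d\<close> ensuring \<open>0 \<le> d\<close>, keep the pressure difference there.  Membership in the ECH alone is too weak when the curve is a single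
  point: the slope of the chord is then arbitrary, and a falling line admits negative flows.
\<close>

lemma chord_form_fixed_flow_nonneg:
  assumes fixed: "l \<in> fixed_pipes B" and W: "W_pipe B l > 0" and E: "valid_ech B l E"
    and lim: "pressure_limits B \<pi> (pipe_from B l)" "pressure_limits B \<pi> (pipe_to B l)"
    and region: "(\<pi> (pipe_from B l) - \<pi> (pipe_to B l), f) \<in> ech_region (W_pipe B l) E"
  shows "0 \<le> f"
proof -
  let ?d = "\<pi> (pipe_from B l) - \<pi> (pipe_to B l)" and ?W = "W_pipe B l"
  obtain a b where E_eq: "E = Chord_Form a b" and chord: "chord_of_curve (weymouth_curve B l) a b"
    using E fixed by (cases E) (auto simp: valid_ech_def)
  have above: "a * ?d + b \<le> f" and "f\<^sup>2 \<le> ?W * ?d"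
    using region E_eq by auto
  then have "0 \<le> ?W * ?d" using zero_le_power2[of f] by linarith
  then have d: "0 \<le> ?d" using W by (simp add: zero_le_mult_iff)
  \<comment> \<open>The flow that the Weymouth equation assigns to the pressures \<open>\<pi>\<close> yields a curve point over \<open>?d\<close>.\<close>
  have "weymouth_constraint B l \<pi> (sqrt (?W * ?d))"
    using d W by (simp add: weymouth_constraint_def weymouth_def sgn1_def)
  then have "(?d, sqrt (?W * ?d)) \<in> weymouth_curve B l"
    using lim by (auto simp: weymouth_curve_def)
  then obtain d1 f1 d2 f2 where
    ends: "(d1, f1) \<in> weymouth_curve B l" "(d2, f2) \<in> weymouth_curve B l"
    and between: "d1 \<le> ?d" "?d \<le> d2"
    and line: "f1 = a * d1 + b" "f2 = a * d2 + b"
    using chord unfolding chord_of_curve_def by fastforce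
  have "0 \<le> a * d1 + b" "0 \<le> a * d2 + b"
    using weymouth_curve_one_sided(1)[OF _ W] ends fixed line by auto
  moreover have "a * d1 \<le> a * ?d \<or> a * d2 \<le> a * ?d"
    using between by (cases "0 \<le> a") (auto intro: mult_left_mono mult_left_mono_neg)
  ultimately show ?thesis using above by linarith
qed

lemma recovery_zero_pressures:
  assumes fin: "finite (gas_nodes B)"
    and feas: "(\<pi>, \<delta>p, \<delta>m) \<in> recovery_feasible B f"
    and zero: "recovery_objective B (\<pi>, \<delta>p, \<delta>m) = 0"
    and i: "i \<in> gas_nodes B"
  shows "pressure_limits B \<pi> i"
proof -
  have nonneg: "\<And>j. j \<in> gas_nodes B \<Longrightarrow> 0 \<le> \<delta>p j \<and> 0 \<le> \<delta>m j"
    using feas by (auto simp: recovery_feasible_def)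
  have "(\<Sum>j\<in>gas_nodes B. \<delta>p j + \<delta>m j) = 0"
    using zero by (simp add: recovery_objective_def sum.distrib)
  then have "\<delta>p i + \<delta>m i = 0"
    using fin i nonneg by (subst (asm) sum_nonneg_eq_0_iff) auto
  then have "\<delta>p i = 0" "\<delta>m i = 0" using nonneg[OF i] by linarith+
  moreover have "(1 - \<delta>m i) * G_node_min B i \<le> \<pi> i" "\<pi> i \<le> (1 + \<delta>p i) * G_node_max B i"
    using feas i by (auto simp: recovery_feasible_def)
  ultimately show ?thesis by (simp add: pressure_limits_def)
qed

lemma recovered_original_feasible:
  assumes wf: "wf_system S" and E: "\<forall>l\<in>pipes (gas S). valid_ech (gas S) l (E l)"
    and x: "convexified_feasible S E x"
    and feas: "(\<pi>, \<delta>p, \<delta>m) \<in> recovery_feasible (gas S) (pipe_flow x)"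
    and zero: "recovery_objective (gas S) (\<pi>, \<delta>p, \<delta>m) = 0"
  shows "original_feasible S (x\<lparr>pressure := \<pi>\<rparr>)"
proof -
  let ?B = "gas S"
  have fin: "finite (gas_nodes ?B)"
    using wf by (simp add: wf_system_def wf_gas_block_def Let_def)
  have lim: "\<forall>i\<in>gas_nodes ?B. pressure_limits ?B \<pi> i"
    using recovery_zero_pressures[OF fin feas zero] by blast
  have comp: "compressor_constraints ?B \<pi>"
    using feas by (simp add: recovery_feasible_def)
  have common: "common_constraints S (x\<lparr>pressure := \<pi>\<rparr>)"
    using x lim comp
    by (simp add: convexified_feasible_def common_constraints_def gas_constraints_def
        coupling_constraints_def gas_balance_def Let_def)
  have "weymouth_constraint ?B l \<pi> (pipe_flow x l)" if l: "l \<in> pipes ?B" for l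
  proof -
    have W: "W_pipe ?B l > 0"
      and nodes: "pipe_from ?B l \<in> gas_nodes ?B" "pipe_to ?B l \<in> gas_nodes ?B"
      using wf l by (auto simp: wf_system_def wf_gas_block_def Let_def)
    have wey: "weymouth ?B l \<pi> (pipe_flow x l)"
      using feas l by (simp add: recovery_feasible_def)
    have "\<pi> (pipe_to ?B l) \<le> \<pi> (pipe_from ?B l)" if "l \<in> fixed_pipes ?B"
    proof -
      have "0 \<le> pipe_flow x l"
      proof (rule chord_form_fixed_flow_nonneg[OF that W])
        show "valid_ech ?B l (E l)" using E l by blast
        show "pressure_limits ?B (pressure x) (pipe_from ?B l)"
          "pressure_limits ?B (pressure x) (pipe_to ?B l)"
          using x nodes
          by (auto simp: convexified_feasible_def common_constraints_def gas_constraints_def Let_def)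
        show "(pressure x (pipe_from ?B l) - pressure x (pipe_to ?B l), pipe_flow x l)
            \<in> ech_region (W_pipe ?B l) (E l)"
          using x l by (simp add: convexified_feasible_def)
      qed
      then show ?thesis using weymouth_flow_nonneg_iff[OF wey W] by simp
    qed
    then show ?thesis using wey by (simp add: weymouth_constraint_def)
  qed
  then show ?thesis using common by (simp add: original_feasible_def)
qed

theorem corollary1:
  fixes S :: "('u, 'n, 'l, 'd, 'w, 'm, 'e, 'c, 'v) energy_system"
    and E :: "'e \<Rightarrow> ech"
    and xs :: "('u, 'n, 'l, 'w, 'm, 'e, 'c, 'v) flow"
    and \<pi>2 \<delta>p \<delta>m :: "'m \<Rightarrow> real"
  assumes "wf_system S"
    and "\<exists>x. original_feasible S x"
    and "\<forall>l\<in>pipes (gas S). valid_ech (gas S) l (E l)"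
    and "is_arg_min (total_cost S) (convexified_feasible S E) xs"
    and "recovery_feasible (gas S) (pipe_flow xs) \<noteq> {}"
    and "(INF z\<in>recovery_feasible (gas S) (pipe_flow xs). recovery_objective (gas S) z) = 0"
    and "(\<pi>2, \<delta>p, \<delta>m) \<in> recovery_feasible (gas S) (pipe_flow xs)"
    and "recovery_objective (gas S) (\<pi>2, \<delta>p, \<delta>m) = 0"
  shows "is_arg_min (total_cost S) (original_feasible S) (xs\<lparr>pressure := \<pi>2\<rparr>)"
proof -
  have opt: "convexified_feasible S E xs"
    "\<And>y. convexified_feasible S E y \<Longrightarrow> \<not> total_cost S y < total_cost S xs"
    using assms(4) by (auto simp: is_arg_min_def)
  have "total_cost S (xs\<lparr>pressure := \<pi>2\<rparr>) = total_cost S xs"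
    by (simp add: total_cost_def)
  then show ?thesis
    using recovered_original_feasible[OF assms(1,3) opt(1) assms(7,8)] opt(2)
      original_feasible_imp_convexified_feasible[OF assms(1,3)]
    by (auto simp: is_arg_min_def)
qed

end
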